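(* Let $D \subseteq \mathbb{R}^d$ and let the (potentially set-valued) functional $T$, with $T(F) \subseteq D$, be defined on a class $\mathcal{F}$ of probability distributions on $D$ which admit a density, $f$, with respect to some dominating measure on $D$. Consider a (measurable) weight function $w : D \to [0,\infty)$. Let $\mathcal{F}^{(w)} \subseteq \mathcal{F}$ denote the subclass of the probability distributions $F \in \mathcal{F}$ (with density $f$) which are such that $w(y) f(y)$ has finite (and nonzero) integral over $D$ with respect to the dominating measure, and the probability measure $F^{(w)}$ with density proportional to $w(y) f(y)$ belongs to $\mathcal{F}$. Define the functional $T^{(w)}$ on $\mathcal{F}^{(w)}$ by $$T^{(w)}(F) = T(F^{(w)}) \subseteq D, \qquad F \in \mathcal{F}^{(w)}.$$ Then the following holds. (a) If $T$ is elicitable relative to $\mathcal{F}$, then $T^{(w)}$ is elicitable relative to $\mathcal{F}^{(w)}$. (b) If the scoring function $S$ is consistent for $T$ relative to $\mathcal{F}$, then $$S^{(w)}(x,y) = w(y) \, S(x,y)$$ is consistent for $T^{(w)}$ relative to $\mathcal{F}^{(w)}$. (c) If $S$ is strictly consistent for $T$ relative to $\mathcal{F}$, then $S^{(w)}$ is strictly consistent for $T^{(w)}$ relative to $\mathcal{F}^{(w)}$.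
   Context: $D$ carries its Borel $\sigma$-algebra. A scoring function is a map $S : D \times D \to [0,\infty)$ (point forecast $x$ first, observation $y$ second), measurable in the second argument, so that $\mathbb{E}_F S(x,Y) \in [0,\infty]$ is defined, where $Y$ denotes a random variable with distribution $F$. For a class $\mathcal{G}$ of probability distributions on $D$ and a functional $U$ assigning to each $F \in \mathcal{G}$ a set $U(F) \subseteq D$: a scoring function $S$ is consistent for $U$ relative to $\mathcal{G}$ if $$\mathbb{E}_F S(t,Y) \le \mathbb{E}_F S(x,Y) \quad \text{for all } F \in \mathcal{G},\ t \in U(F),\ x \in D.$$ It is strictly consistent if it is consistent and equality in this inequality implies that $x \in U(F)$. The functional $U$ is elicitable relative to $\mathcal{G}$ if there exists a scoring function that is strictly consistent for $U$ relative to $\mathcal{G}$. *)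

theory Defs
  imports "HOL-Probability.Probability"
begin

definition borel_on :: "'a::topological_space set \<Rightarrow> 'a measure" where
  "borel_on D = restrict_space borel D"

definition prob_distribution_on :: "'a::topological_space set \<Rightarrow> 'a measure \<Rightarrow> bool" where
  "prob_distribution_on D F \<longleftrightarrow> prob_space F \<and> sets F = sets (borel_on D)"

text \<open>Only the values of \<open>S\<close> on \<open>D \<times> D\<close> matter.\<close>

definition scoring_function ::
    "'a::topological_space set \<Rightarrow> ('a \<Rightarrow> 'a \<Rightarrow> real) \<Rightarrow> bool" where
  "scoring_function D S \<longleftrightarrow>
     (\<forall>x\<in>D. \<forall>y\<in>D. 0 \<le> S x y) \<and> (\<forall>x\<in>D. S x \<in> borel_measurable (borel_on D))"

text \<open>The expected score may be infinite, hence the extended nonnegative integral.\<close>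

definition expected_score :: "'a measure \<Rightarrow> ('a \<Rightarrow> 'a \<Rightarrow> real) \<Rightarrow> 'a \<Rightarrow> ennreal" where
  "expected_score F S x = (\<integral>\<^sup>+ y. ennreal (S x y) \<partial>F)"

definition consistent ::
    "'a::topological_space set \<Rightarrow> ('a \<Rightarrow> 'a \<Rightarrow> real) \<Rightarrow> ('a measure \<Rightarrow> 'a set) \<Rightarrow> 'a measure set \<Rightarrow> bool" where
  "consistent D S U \<G> \<longleftrightarrow>
     scoring_function D S \<and>
     (\<forall>F\<in>\<G>. \<forall>t\<in>U F. \<forall>x\<in>D. expected_score F S t \<le> expected_score F S x)"

definition strictly_consistent ::
    "'a::topological_space set \<Rightarrow> ('a \<Rightarrow> 'a \<Rightarrow> real) \<Rightarrow> ('a measure \<Rightarrow> 'a set) \<Rightarrow> 'a measure set \<Rightarrow> bool" where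
  "strictly_consistent D S U \<G> \<longleftrightarrow>
     consistent D S U \<G> \<and>
     (\<forall>F\<in>\<G>. \<forall>t\<in>U F. \<forall>x\<in>D. expected_score F S t = expected_score F S x \<longrightarrow> x \<in> U F)"

definition elicitable ::
    "'a::topological_space set \<Rightarrow> ('a measure \<Rightarrow> 'a set) \<Rightarrow> 'a measure set \<Rightarrow> bool" where
  "elicitable D U \<G> \<longleftrightarrow> (\<exists>S. strictly_consistent D S U \<G>)"

definition has_density :: "'a measure \<Rightarrow> 'a measure \<Rightarrow> ('a \<Rightarrow> real) \<Rightarrow> bool" where
  "has_density \<mu> F f \<longleftrightarrow>
     f \<in> borel_measurable \<mu> \<and> (\<forall>y\<in>space \<mu>. 0 \<le> f y) \<and> F = density \<mu> (\<lambda>y. ennreal (f y))"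

text \<open>In the following, \<open>f\<close> assigns to each distribution \<open>F\<close> of the class a density \<open>f F\<close>
  with respect to \<open>\<mu>\<close>. The choice of this version of the density is immaterial, since
  \<open>w y * f F y\<close> integrates over a set \<open>A\<close> to the integral of \<open>w\<close> over \<open>A\<close> with respect to \<open>F\<close>.\<close>

definition weighted_distribution ::
    "'a measure \<Rightarrow> ('a measure \<Rightarrow> 'a \<Rightarrow> real) \<Rightarrow> ('a \<Rightarrow> real) \<Rightarrow> 'a measure \<Rightarrow> 'a measure" where
  "weighted_distribution \<mu> f w F =
     density \<mu> (\<lambda>y. ennreal (w y * f F y / (\<integral>z. w z * f F z \<partial>\<mu>)))"

definition weighted_class ::
    "'a measure \<Rightarrow> ('a measure \<Rightarrow> 'a \<Rightarrow> real) \<Rightarrow> ('a \<Rightarrow> real) \<Rightarrow> 'a measure set \<Rightarrow> 'a measure set" where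
  "weighted_class \<mu> f w \<F> =
     {F \<in> \<F>. integrable \<mu> (\<lambda>y. w y * f F y) \<and> (\<integral>y. w y * f F y \<partial>\<mu>) \<noteq> 0 \<and>
             weighted_distribution \<mu> f w F \<in> \<F>}"

definition weighted_functional ::
    "'a measure \<Rightarrow> ('a measure \<Rightarrow> 'a \<Rightarrow> real) \<Rightarrow> ('a \<Rightarrow> real) \<Rightarrow> ('a measure \<Rightarrow> 'a set) \<Rightarrow>
     'a measure \<Rightarrow> 'a set" where
  "weighted_functional \<mu> f w T F = T (weighted_distribution \<mu> f w F)"

definition weighted_score :: "('a \<Rightarrow> real) \<Rightarrow> ('a \<Rightarrow> 'a \<Rightarrow> real) \<Rightarrow> 'a \<Rightarrow> 'a \<Rightarrow> real" where
  "weighted_score w S x y = w y * S x y"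

end

theory Submission
  imports Defs
begin

text \<open>
  Weighting the score and weighting the distribution are the same change of measure. If
  \<open>F\<close> has density \<open>f\<close> and \<open>c = \<integral> w f d\<mu>\<close>, then \<open>F\<^sup>w\<close> has density \<open>w f / c\<close>, so that
  the two integrals
  \<open>E\<^sub>F (w(Y) S(x,Y)) = \<integral> f w S(x,\<cdot>) d\<mu>\<close> and \<open>E\<^bsub>F\<^sup>w\<^esub> S(x,Y) = \<integral> (w f / c) S(x,\<cdot>) d\<mu>\<close>
  differ only by the factor \<open>c\<close>, which does not depend on the forecast \<open>x\<close>
  (\<open>expected_weighted_score\<close>). Because \<open>0 < c < \<infinity>\<close>, multiplication by \<open>c\<close> preserves and
  reflects both order and equality on \<open>[0,\<infinity>]\<close>. Every comparison of weighted
  scores under \<open>F\<close> is therefore a comparison of original scores under \<open>F\<^sup>w\<close>, which lies in the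
  original class, and \<open>F\<^sup>w\<close> is where the weighted functional evaluates \<open>T\<close>. This gives the two
  statements on consistency (\<open>consistent_pullback\<close>, \<open>strictly_consistent_pullback\<close>), and the one
  on elicitability follows by weighting a strictly consistent score.
\<close>

lemma space_borel_on [simp]: "space (borel_on D) = D"
  by (simp add: borel_on_def space_restrict_space)

lemma scoring_function_weighted:
  assumes S: "scoring_function D S"
    and w: "w \<in> borel_measurable (borel_on D)" "\<And>y. y \<in> D \<Longrightarrow> 0 \<le> w y"
  shows "scoring_function D (weighted_score w S)"
proof -
  have "weighted_score w S x \<in> borel_measurable (borel_on D)" if "x \<in> D" for x
  proof -
    have "S x \<in> borel_measurable (borel_on D)"
      using S that by (simp add: scoring_function_def)
    then have "(\<lambda>y. w y * S x y) \<in> borel_measurable (borel_on D)"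
      using w(1) by simp
    then show ?thesis
      by (simp add: weighted_score_def [abs_def])
  qed
  then show ?thesis
    using S w(2) by (auto simp: scoring_function_def weighted_score_def)
qed

text \<open>
  In the integral, \<open>w\<close> can be read as part of the score or as part of the density. The identity
  holds in \<open>[0,\<infinity>]\<close>, hence also for forecasts with infinite expected score.
\<close>

lemma expected_weighted_score:
  assumes sets: "sets \<mu> = sets (borel_on D)"
    and dens: "has_density \<mu> F (f F)"
    and w: "w \<in> borel_measurable (borel_on D)" "\<And>y. y \<in> D \<Longrightarrow> 0 \<le> w y"
    and S: "scoring_function D S"
    and c: "0 < (\<integral>z. w z * f F z \<partial>\<mu>)"
    and x: "x \<in> D"
  shows "expected_score F (weighted_score w S) x =
    ennreal (\<integral>z. w z * f F z \<partial>\<mu>) * expected_score (weighted_distribution \<mu> f w F) S x"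
proof -
  let ?c = "\<integral>z. w z * f F z \<partial>\<mu>"
  have space: "space \<mu> = D"
    using sets_eq_imp_space_eq [OF sets] by simp
  have f_meas [measurable]: "f F \<in> borel_measurable \<mu>"
    and f_nonneg: "\<And>y. y \<in> D \<Longrightarrow> 0 \<le> f F y"
    and F: "F = density \<mu> (\<lambda>y. ennreal (f F y))"
    using dens by (auto simp: has_density_def space)
  have w_meas [measurable]: "w \<in> borel_measurable \<mu>"
    using w(1) measurable_cong_sets [OF sets refl] by blast
  have S_meas [measurable]: "S x \<in> borel_measurable \<mu>"
    using S x measurable_cong_sets [OF sets refl] unfolding scoring_function_def by blast
  have S_nonneg: "\<And>y. y \<in> D \<Longrightarrow> 0 \<le> S x y"
    using S x by (simp add: scoring_function_def)
  have "expected_score F (weighted_score w S) x =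
      (\<integral>\<^sup>+ y. ennreal (w y * S x y) \<partial>density \<mu> (\<lambda>y. ennreal (f F y)))"
    by (subst F) (simp add: expected_score_def weighted_score_def)
  also have "\<dots> = (\<integral>\<^sup>+ y. ennreal (f F y) * ennreal (w y * S x y) \<partial>\<mu>)"
    by (rule nn_integral_density) measurable
  also have "\<dots> = (\<integral>\<^sup>+ y. ennreal ?c * (ennreal (w y * f F y / ?c) * ennreal (S x y)) \<partial>\<mu>)"
  proof (rule nn_integral_cong)
    fix y assume "y \<in> space \<mu>"
    then have "y \<in> D" by (simp add: space)
    then show "ennreal (f F y) * ennreal (w y * S x y) =
        ennreal ?c * (ennreal (w y * f F y / ?c) * ennreal (S x y))"
      using c f_nonneg [of y] w(2) [of y] S_nonneg [of y]
      by (simp add: ennreal_mult [symmetric] mult_ac)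
  qed
  also have "\<dots> = ennreal ?c * (\<integral>\<^sup>+ y. ennreal (w y * f F y / ?c) * ennreal (S x y) \<partial>\<mu>)"
    by (rule nn_integral_cmult) measurable
  also have "(\<integral>\<^sup>+ y. ennreal (w y * f F y / ?c) * ennreal (S x y) \<partial>\<mu>) =
      expected_score (weighted_distribution \<mu> f w F) S x"
    unfolding expected_score_def weighted_distribution_def
    by (rule nn_integral_density [symmetric]) measurable
  finally show ?thesis .
qed

text \<open>
  Consistency only compares expected scores of different forecasts under one distribution. It
  therefore transfers along any map \<open>G\<close> of distributions that changes expected scores by a factor
  independent of the forecast; the factor may vary with the distribution. It is given only for
  forecasts in \<open>D\<close>, and reaches both sides of the comparison because \<open>T\<close> takes values in \<open>D\<close>.
\<close>

lemma consistent_pullback: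
  assumes S: "consistent D S T \<F>"
    and S': "scoring_function D S'"
    and G: "\<And>F. F \<in> \<G> \<Longrightarrow> G F \<in> \<F>"
    and T: "\<And>F. F \<in> \<F> \<Longrightarrow> T F \<subseteq> D"
    and scale: "\<And>F x. F \<in> \<G> \<Longrightarrow> x \<in> D \<Longrightarrow>
      expected_score F S' x = ennreal (c F) * expected_score (G F) S x"
  shows "consistent D S' (\<lambda>F. T (G F)) \<G>"
  unfolding consistent_def
proof (intro conjI ballI S')
  fix F t x
  assume F: "F \<in> \<G>" and t: "t \<in> T (G F)" and x: "x \<in> D"
  have "expected_score (G F) S t \<le> expected_score (G F) S x"
    using S G [OF F] t x by (simp add: consistent_def)
  moreover have "t \<in> D"
    using T [OF G [OF F]] t by blast
  ultimately show "expected_score F S' t \<le> expected_score F S' x"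
    using F x by (simp add: scale mult_left_mono)
qed

text \<open>
  Strictness asks in addition that equality of scores can be pulled back, so here the factor has
  to be cancelled. This is why it is a positive real: \<open>0\<close> would identify all scores, and \<open>\<infinity>\<close> all
  positive ones.
\<close>

lemma strictly_consistent_pullback:
  assumes S: "strictly_consistent D S T \<F>"
    and S': "scoring_function D S'"
    and G: "\<And>F. F \<in> \<G> \<Longrightarrow> G F \<in> \<F>"
    and T: "\<And>F. F \<in> \<F> \<Longrightarrow> T F \<subseteq> D"
    and pos: "\<And>F. F \<in> \<G> \<Longrightarrow> 0 < c F"
    and scale: "\<And>F x. F \<in> \<G> \<Longrightarrow> x \<in> D \<Longrightarrow>
      expected_score F S' x = ennreal (c F) * expected_score (G F) S x"
  shows "strictly_consistent D S' (\<lambda>F. T (G F)) \<G>"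
  unfolding strictly_consistent_def
proof (intro conjI ballI impI)
  show "consistent D S' (\<lambda>F. T (G F)) \<G>"
  proof (rule consistent_pullback [OF _ S' G T scale])
    show "consistent D S T \<F>"
      using S by (simp add: strictly_consistent_def)
  qed
next
  fix F t x
  assume F: "F \<in> \<G>" and t: "t \<in> T (G F)" and x: "x \<in> D"
    and eq: "expected_score F S' t = expected_score F S' x"
  have "t \<in> D"
    using T [OF G [OF F]] t by blast
  then have "ennreal (c F) * expected_score (G F) S t = ennreal (c F) * expected_score (G F) S x"
    using eq by (simp add: scale [OF F] x)
  then have "expected_score (G F) S t = expected_score (G F) S x"
    using pos [OF F] by (simp add: ennreal_mult_cancel_left)
  then show "x \<in> T (G F)"
    using S G [OF F] t x by (simp add: strictly_consistent_def)
qed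

theorem theorem2p7:
  fixes D :: "(real ^ 'd) set"
    and \<mu> :: "(real ^ 'd) measure"
    and \<F> :: "(real ^ 'd) measure set"
    and f :: "(real ^ 'd) measure \<Rightarrow> real ^ 'd \<Rightarrow> real"
    and T :: "(real ^ 'd) measure \<Rightarrow> (real ^ 'd) set"
    and w :: "real ^ 'd \<Rightarrow> real"
  assumes dominating: "sets \<mu> = sets (borel_on D)"
    and distributions: "\<And>F. F \<in> \<F> \<Longrightarrow> prob_distribution_on D F"
    and densities: "\<And>F. F \<in> \<F> \<Longrightarrow> has_density \<mu> F (f F)"
    and functional: "\<And>F. F \<in> \<F> \<Longrightarrow> T F \<subseteq> D"
    and weight_measurable: "w \<in> borel_measurable (borel_on D)"
    and weight_nonneg: "\<And>y. y \<in> D \<Longrightarrow> 0 \<le> w y"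
  shows "(elicitable D T \<F> \<longrightarrow>
            elicitable D (weighted_functional \<mu> f w T) (weighted_class \<mu> f w \<F>)) \<and>
         (\<forall>S. consistent D S T \<F> \<longrightarrow>
            consistent D (weighted_score w S) (weighted_functional \<mu> f w T) (weighted_class \<mu> f w \<F>)) \<and>
         (\<forall>S. strictly_consistent D S T \<F> \<longrightarrow>
            strictly_consistent D (weighted_score w S) (weighted_functional \<mu> f w T) (weighted_class \<mu> f w \<F>))"
proof -
  let ?\<G> = "weighted_class \<mu> f w \<F>"
  let ?G = "weighted_distribution \<mu> f w"
  let ?c = "\<lambda>F. \<integral>z. w z * f F z \<partial>\<mu>"
  have U: "weighted_functional \<mu> f w T = (\<lambda>F. T (?G F))"
    by (simp add: fun_eq_iff weighted_functional_def)
  have class_base: "F \<in> \<F>" and class_weighted: "?G F \<in> \<F>" if "F \<in> ?\<G>" for F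
    using that by (auto simp: weighted_class_def)
  have pos: "0 < ?c F" if F: "F \<in> ?\<G>" for F
  proof -
    have "space \<mu> = D"
      using sets_eq_imp_space_eq [OF dominating] by simp
    then have "0 \<le> ?c F"
      using densities [OF class_base [OF F]] weight_nonneg
      by (intro Bochner_Integration.integral_nonneg) (auto simp: has_density_def)
    moreover have "?c F \<noteq> 0"
      using F by (simp add: weighted_class_def)
    ultimately show ?thesis by simp
  qed
  have scale: "expected_score F (weighted_score w S) x = ennreal (?c F) * expected_score (?G F) S x"
    if "scoring_function D S" "F \<in> ?\<G>" "x \<in> D" for S F x
    by (rule expected_weighted_score [OF dominating densities [OF class_base] weight_measurable
          weight_nonneg _ pos]) (use that in auto)
  have cons: "consistent D (weighted_score w S) (weighted_functional \<mu> f w T) ?\<G>"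
    if S: "consistent D S T \<F>" for S
  proof -
    have "scoring_function D S"
      using S by (simp add: consistent_def)
    then show ?thesis
      unfolding U
      using scoring_function_weighted [OF _ weight_measurable weight_nonneg]
      by (intro consistent_pullback [where c = ?c, OF S]) (simp_all add: class_weighted functional scale)
  qed
  have strict: "strictly_consistent D (weighted_score w S) (weighted_functional \<mu> f w T) ?\<G>"
    if S: "strictly_consistent D S T \<F>" for S
  proof -
    have "scoring_function D S"
      using S by (simp add: strictly_consistent_def consistent_def)
    then show ?thesis
      unfolding U
      using scoring_function_weighted [OF _ weight_measurable weight_nonneg]
      by (intro strictly_consistent_pullback [where c = ?c, OF S])
        (simp_all add: class_weighted functional pos scale)
  qed
  show ?thesis
    using cons strict unfolding elicitable_def by blast
qed

end
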